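(* Let $m > 2$ and $n \geq 1$ be integers and let $M_{2mn} = \langle a, b : a^m = b^{2n} = 1, bab^{-1} = a^{-1} \rangle$. Then the Laplacian spectrum of the non-commuting graph $\mathcal{A}_{M_{2mn}}$ of $M_{2mn}$ is $$\{0, (mn)^{mn-n-1}, (2mn-2n)^{mn-m}, (2mn-n)^m\}$$ if $m$ is odd, and $$\{0, (mn)^{mn-2n-1}, (2mn-4n)^{mn-\frac{m}{2}}, (2mn-2n)^{\frac{m}{2}}\}$$ if $m$ is even.
   Context: For a finite non-abelian group $G$ with centre $Z(G)$, the non-commuting graph $\mathcal{A}_G$ is the simple undirected graph with vertex set $G \setminus Z(G)$ in which two vertices $x,y$ are adjacent if and only if $xy \neq yx$. The Laplacian matrix of a finite graph is $D - A$, with $D$ the degree matrix and $A$ the adjacency matrix. The Laplacian spectrum is the multiset of eigenvalues of the Laplacian matrix; $\{\dots,\alpha^{a},\dots\}$ means the eigenvalue $\alpha$ is listed $a$ times (no exponent means once, exponent $0$ means the entry is absent, and if listed values coincide their multiplicities add). *)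

theory Defs
  imports
    "HOL-Algebra.Group"
    "HOL-Library.Multiset"
    "HOL-Computational_Algebra.Polynomial"
    "Jordan_Normal_Form.Char_Poly"
    "Graph_Theory.Pair_Digraph"
begin

section \<open>Groups given by generators and relations\<close>

text \<open>
  A word over the generators and their formal inverses is a list of letters. The generating set
  is the whole type \<open>'g\<close>, and a relation \<open>u = v\<close> is a pair of words.
\<close>

datatype 'g letter = Pos 'g | Neg 'g

text \<open>
  The least congruence on the free monoid of words that cancels \<open>g g\<^sup>-\<^sup>1\<close> and \<open>g\<^sup>-\<^sup>1 g\<close> and identifies
  the two sides of each relation. Its quotient is the free group modulo the normal closure of the
  relators \<open>u v\<^sup>-\<^sup>1\<close>.
\<close>

inductive word_eq :: "('g letter list \<times> 'g letter list) set \<Rightarrow> 'g letter list \<Rightarrow> 'g letter list \<Rightarrow> bool"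
  for R where
  rel: "(u, v) \<in> R \<Longrightarrow> word_eq R u v"
| cancel_Pos_Neg: "word_eq R [Pos g, Neg g] []"
| cancel_Neg_Pos: "word_eq R [Neg g, Pos g] []"
| refl: "word_eq R u u"
| sym: "word_eq R u v \<Longrightarrow> word_eq R v u"
| trans: "word_eq R u v \<Longrightarrow> word_eq R v w \<Longrightarrow> word_eq R u w"
| append: "word_eq R u u' \<Longrightarrow> word_eq R v v' \<Longrightarrow> word_eq R (u @ v) (u' @ v')"

definition word_class ::
  "('g letter list \<times> 'g letter list) set \<Rightarrow> 'g letter list \<Rightarrow> 'g letter list set" where
  "word_class R u = {v. word_eq R u v}"

definition presented_group ::
  "('g letter list \<times> 'g letter list) set \<Rightarrow> 'g letter list set monoid" where
  "presented_group R =
     \<lparr>carrier = range (word_class R),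
      monoid.mult = (\<lambda>U V. \<Union>u\<in>U. \<Union>v\<in>V. word_class R (u @ v)),
      one = word_class R []\<rparr>"

lemma word_class_eq_iff: "word_class R u = word_class R v \<longleftrightarrow> word_eq R u v"
proof
  assume "word_class R u = word_class R v"
  then have "v \<in> word_class R u"
    by (simp add: word_class_def word_eq.refl)
  then show "word_eq R u v"
    by (simp add: word_class_def)
next
  assume "word_eq R u v"
  then have "word_eq R u w \<longleftrightarrow> word_eq R v w" for w
    by (meson word_eq.sym word_eq.trans)
  then show "word_class R u = word_class R v"
    by (simp add: word_class_def)
qed

lemma presented_group_mult:
  "word_class R u \<otimes>\<^bsub>presented_group R\<^esub> word_class R v = word_class R (u @ v)"
proof -
  have "word_class R (u' @ v') = word_class R (u @ v)"
    if "u' \<in> word_class R u" "v' \<in> word_class R v" for u' v'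
  proof -
    have "word_eq R u u'" "word_eq R v v'"
      using that by (simp_all add: word_class_def)
    then show ?thesis
      unfolding word_class_eq_iff by (rule word_eq.sym[OF word_eq.append])
  qed
  then have "(\<Union>u'\<in>word_class R u. \<Union>v'\<in>word_class R v. word_class R (u' @ v'))
      = (\<Union>u'\<in>word_class R u. \<Union>v'\<in>word_class R v. word_class R (u @ v))"
    by (intro SUP_cong HOL.refl)
  also have "\<dots> = word_class R (u @ v)"
  proof -
    have "u \<in> word_class R u" "v \<in> word_class R v"
      by (simp_all add: word_class_def word_eq.refl)
    then show ?thesis by blast
  qed
  finally show ?thesis
    by (simp add: presented_group_def)
qed

fun inv_letter :: "'g letter \<Rightarrow> 'g letter" where
  "inv_letter (Pos g) = Neg g"
| "inv_letter (Neg g) = Pos g"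

lemma word_eq_inverse: "word_eq R (rev (map inv_letter u) @ u) []"
proof (induction u)
  case Nil
  show ?case by (simp add: word_eq.refl)
next
  case (Cons x u)
  have "word_eq R [inv_letter x, x] []"
    by (cases x) (simp_all add: word_eq.cancel_Pos_Neg word_eq.cancel_Neg_Pos)
  then have "word_eq R (rev (map inv_letter u) @ ([inv_letter x, x] @ u))
      (rev (map inv_letter u) @ ([] @ u))"
    by (intro word_eq.append word_eq.refl)
  then have "word_eq R (rev (map inv_letter (x # u)) @ x # u) (rev (map inv_letter u) @ u)"
    by simp
  then show ?case
    using Cons.IH by (rule word_eq.trans)
qed

lemma group_presented_group: "group (presented_group R)"
proof (rule groupI)
  show "\<exists>y\<in>carrier (presented_group R). y \<otimes>\<^bsub>presented_group R\<^esub> x = \<one>\<^bsub>presented_group R\<^esub>"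
    if "x \<in> carrier (presented_group R)" for x
  proof -
    from that obtain u where u: "x = word_class R u"
      by (auto simp: presented_group_def)
    have "word_class R (rev (map inv_letter u)) \<otimes>\<^bsub>presented_group R\<^esub> x
        = \<one>\<^bsub>presented_group R\<^esub>"
      unfolding u presented_group_mult
      by (simp add: presented_group_def word_class_eq_iff word_eq_inverse)
    then show ?thesis
      by (auto simp: presented_group_def)
  qed
next
  fix x y
  assume "x \<in> carrier (presented_group R)" "y \<in> carrier (presented_group R)"
  then obtain u v where "x = word_class R u" "y = word_class R v"
    by (auto simp: presented_group_def)
  then have "x \<otimes>\<^bsub>presented_group R\<^esub> y = word_class R (u @ v)"
    by (simp add: presented_group_mult)
  then show "x \<otimes>\<^bsub>presented_group R\<^esub> y \<in> carrier (presented_group R)"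
    by (simp add: presented_group_def)
next
  show "\<one>\<^bsub>presented_group R\<^esub> \<in> carrier (presented_group R)"
    by (simp add: presented_group_def)
next
  fix x y z
  assume "x \<in> carrier (presented_group R)" "y \<in> carrier (presented_group R)"
    "z \<in> carrier (presented_group R)"
  then obtain u v w where "x = word_class R u" "y = word_class R v" "z = word_class R w"
    by (auto simp: presented_group_def)
  then show "x \<otimes>\<^bsub>presented_group R\<^esub> y \<otimes>\<^bsub>presented_group R\<^esub> z
      = x \<otimes>\<^bsub>presented_group R\<^esub> (y \<otimes>\<^bsub>presented_group R\<^esub> z)"
    by (simp add: presented_group_mult)
next
  fix x
  assume "x \<in> carrier (presented_group R)"
  then obtain u where u: "x = word_class R u"
    by (auto simp: presented_group_def)
  have "\<one>\<^bsub>presented_group R\<^esub> = word_class R []"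
    by (simp add: presented_group_def)
  then show "\<one>\<^bsub>presented_group R\<^esub> \<otimes>\<^bsub>presented_group R\<^esub> x = x"
    by (simp add: u presented_group_mult)
qed

datatype gen_ab = Gen_a | Gen_b

definition M_group :: "nat \<Rightarrow> nat \<Rightarrow> gen_ab letter list set monoid" where
  "M_group m n = presented_group
     {(replicate m (Pos Gen_a), []),
      (replicate (2 * n) (Pos Gen_b), []),
      ([Pos Gen_b, Pos Gen_a, Neg Gen_b], [Neg Gen_a])}"


section \<open>The non-commuting graph\<close>

definition group_center :: "('a, 'b) monoid_scheme \<Rightarrow> 'a set" where
  "group_center G = {z \<in> carrier G. \<forall>x \<in> carrier G. z \<otimes>\<^bsub>G\<^esub> x = x \<otimes>\<^bsub>G\<^esub> z}"

text \<open>
  As usual for pair digraphs, an undirected edge between \<open>x\<close> and \<open>y\<close> is represented by the two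
  arcs \<open>(x, y)\<close> and \<open>(y, x)\<close>, so that the degree of a vertex is its out-degree.
\<close>

definition non_commuting_graph :: "('a, 'b) monoid_scheme \<Rightarrow> 'a pair_pre_digraph" where
  "non_commuting_graph G =
     (let V = carrier G - group_center G in
      \<lparr>pverts = V, parcs = {(x, y) \<in> V \<times> V. x \<otimes>\<^bsub>G\<^esub> y \<noteq> y \<otimes>\<^bsub>G\<^esub> x}\<rparr>)"

lemma pair_graph_non_commuting_graph:
  assumes "finite (carrier G)"
  shows "pair_graph (non_commuting_graph G)"
proof
  show "finite (pverts (non_commuting_graph G))"
    using assms by (simp add: non_commuting_graph_def Let_def)
  show "finite (parcs (non_commuting_graph G))"
    by (rule finite_subset[of _ "carrier G \<times> carrier G"])
      (use assms in \<open>auto simp: non_commuting_graph_def Let_def\<close>)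
  show "symmetric (with_proj (non_commuting_graph G))"
    by (auto simp: symmetric_def sym_def non_commuting_graph_def Let_def)
qed (auto simp: non_commuting_graph_def Let_def)


section \<open>Laplacian spectrum\<close>

text \<open>The matrices of a graph with respect to an enumeration \<open>xs\<close> of its vertices.\<close>

definition adjacency_matrix :: "'a pair_pre_digraph \<Rightarrow> 'a list \<Rightarrow> real mat" where
  "adjacency_matrix G xs = mat (length xs) (length xs)
     (\<lambda>(i, j). if (xs ! i, xs ! j) \<in> parcs G then 1 else 0)"

definition degree_matrix :: "'a pair_pre_digraph \<Rightarrow> 'a list \<Rightarrow> real mat" where
  "degree_matrix G xs = mat (length xs) (length xs)
     (\<lambda>(i, j). if i = j then real (out_degree (with_proj G) (xs ! i)) else 0)"

definition laplacian_matrix :: "'a pair_pre_digraph \<Rightarrow> 'a list \<Rightarrow> real mat" where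
  "laplacian_matrix G xs = degree_matrix G xs - adjacency_matrix G xs"

text \<open>
  Eigenvalues are counted with algebraic multiplicity. The Laplacian of an undirected graph is a
  real symmetric matrix, so all its eigenvalues are real and this agrees with the geometric
  multiplicity. The choice of the enumeration is immaterial, see \<open>laplacian_spectrum_eq\<close> below.
\<close>

definition laplacian_spectrum :: "'a pair_pre_digraph \<Rightarrow> real multiset" where
  "laplacian_spectrum G =
     proots (char_poly (laplacian_matrix G (SOME xs. distinct xs \<and> set xs = pverts G)))"

lemma laplacian_similar:
  assumes xs: "distinct xs" and ys: "distinct ys" and eq: "set xs = set ys"
  shows "similar_mat (laplacian_matrix G xs) (laplacian_matrix G ys)"
proof -
  define n where "n = length xs"
  have n': "length ys = n"
    using assms by (metis distinct_card n_def)
  have "\<forall>i<n. \<exists>j<n. ys ! j = xs ! i"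
    using eq n' by (metis in_set_conv_nth n_def nth_mem)
  then obtain f where f: "\<And>i. i < n \<Longrightarrow> f i < n" "\<And>i. i < n \<Longrightarrow> ys ! f i = xs ! i"
    by metis
  have "\<forall>j<n. \<exists>i<n. xs ! i = ys ! j"
    using eq n' by (metis in_set_conv_nth n_def nth_mem)
  then obtain g where g: "\<And>i. i < n \<Longrightarrow> g i < n" "\<And>i. i < n \<Longrightarrow> xs ! g i = ys ! i"
    by metis
  have gf: "g (f i) = i" if "i < n" for i
    using that f g xs by (metis n_def nth_eq_iff_index_eq)
  have fg: "f (g i) = i" if "i < n" for i
    using that f g ys n' by (metis nth_eq_iff_index_eq)
  define P :: "real mat" where "P = mat n n (\<lambda>(i, j). if j = f i then 1 else 0)"
  define Q :: "real mat" where "Q = mat n n (\<lambda>(i, j). if j = g i then 1 else 0)"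
  have [simp]: "P \<in> carrier_mat n n" "Q \<in> carrier_mat n n"
    by (auto simp: P_def Q_def)
  have L: "laplacian_matrix G xs \<in> carrier_mat n n" "laplacian_matrix G ys \<in> carrier_mat n n"
    using n' by (auto simp: laplacian_matrix_def adjacency_matrix_def n_def)
  have PQ: "P * Q = 1\<^sub>m n"
    by (rule eq_matI)
      (auto simp: P_def Q_def scalar_prod_def f gf if_distrib[of "\<lambda>x. x * _"] cong: if_cong)
  have QP: "Q * P = 1\<^sub>m n"
    by (rule eq_matI)
      (auto simp: P_def Q_def scalar_prod_def g fg if_distrib[of "\<lambda>x. x * _"] cong: if_cong)
  have PL: "P * laplacian_matrix G ys = mat n n (\<lambda>(i, j). laplacian_matrix G ys $$ (f i, j))"
    using L(2)
    by (intro eq_matI)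
      (auto simp: P_def scalar_prod_def f if_distrib[of "\<lambda>x. x * _"] cong: if_cong)
  have *: "k = g j \<longleftrightarrow> j = f k" if "j < n" "k < n" for j k
    using gf fg that by auto
  have "laplacian_matrix G xs $$ (i, j) = (P * laplacian_matrix G ys * Q) $$ (i, j)"
    if ij: "i < n" "j < n" for i j
  proof -
    have "(P * laplacian_matrix G ys * Q) $$ (i, j)
        = (\<Sum>k<n. laplacian_matrix G ys $$ (f i, k) * (if j = g k then 1 else 0))"
      using ij unfolding PL by (auto simp: Q_def scalar_prod_def lessThan_atLeast0)
    also have "\<dots> = (\<Sum>k<n. if k = f j then laplacian_matrix G ys $$ (f i, f j) else 0)"
      using ij * by (intro sum.cong) auto
    also have "\<dots> = laplacian_matrix G ys $$ (f i, f j)"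
      using ij f by simp
    also have "\<dots> = laplacian_matrix G xs $$ (i, j)"
    proof -
      have "f i = f j \<longleftrightarrow> i = j"
        using gf ij by metis
      then show ?thesis
        using ij f n'
        by (simp add: laplacian_matrix_def degree_matrix_def adjacency_matrix_def
            flip: n_def)
    qed
    finally show ?thesis by simp
  qed
  then have "laplacian_matrix G xs = P * laplacian_matrix G ys * Q"
    using L by (intro eq_matI) (auto simp: P_def Q_def)
  then show ?thesis
    by (intro similar_matI[of _ _ P Q n] PQ QP) (use L in simp)
qed

lemma laplacian_spectrum_eq:
  assumes "distinct xs" "set xs = pverts G"
  shows "laplacian_spectrum G = proots (char_poly (laplacian_matrix G xs))"
proof -
  let ?ys = "SOME xs. distinct xs \<and> set xs = pverts G"
  have "distinct ?ys \<and> set ?ys = pverts G"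
    by (rule someI[of _ xs]) (use assms in simp)
  then show ?thesis
    unfolding laplacian_spectrum_def
    using char_poly_similar[OF laplacian_similar[of ?ys xs G]] assms by simp
qed

end

theory Submission
  imports Defs
begin

text \<open>
  Write every element as \<open>a\<^sup>i b\<^sup>j\<close>. Two such elements commute iff \<open>i + (-1)\<^sup>j k\<close> and \<open>k + (-1)\<^sup>l i\<close> agree
  modulo \<open>m\<close>. With \<open>d = m\<close> for odd \<open>m\<close> and \<open>d = m div 2\<close> for even \<open>m\<close>, so that \<open>m\<close> divides \<open>2 x\<close> iff
  \<open>d\<close> divides \<open>x\<close>, this makes non-commutation of non-central elements the relation of lying in
  different parts, where one part consists of the elements with even \<open>j\<close> and the others, for odd \<open>j\<close>,
  are indexed by \<open>i mod d\<close>. So the graph is complete multipartite. On a complete multipartite graph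
  with \<open>N\<close> vertices and parts \<open>P\<close>, the Laplacian kills the constant function, maps \<open>1\<^sub>P\<close> to
  \<open>N 1\<^sub>P - |P| 1\<close> and scales \<open>e\<^sub>v - e\<^sub>w\<close> with \<open>v, w \<in> P\<close> by \<open>N - |P|\<close>; in a basis of such vectors it is
  upper triangular, and the spectrum is read off the diagonal.
\<close>

section \<open>Laplacian spectrum of complete multipartite graphs\<close>

lemma sum_singleton_mset: "(\<Sum>i\<in>A. {#c#}) = replicate_mset (card A) c"
  by (induction A rule: infinite_finite_induct) auto

lemma proots_prod_list_linear:
  "proots (\<Prod>a\<leftarrow>as. [:- a, 1:]) = mset (as :: 'a :: idom list)"
proof (induction as)
  case (Cons a as)
  have "0 \<notin> set (map (\<lambda>a. [:- a, 1:]) as)"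
    by auto
  then have "(\<Prod>a\<leftarrow>as. [:- a, 1:]) \<noteq> 0"
    by (simp only: prod_list_zero_iff) blast
  then show ?case
    using Cons by (simp add: proots_mult del: mult_pCons_left)
qed simp

text \<open>Over a field a left inverse of a square matrix is two-sided, so one product and the
  intertwining identity suffice for similarity.\<close>

lemma similar_matI_left_inverse:
  fixes A :: "'a :: field mat"
  assumes "A \<in> carrier_mat N N" "T \<in> carrier_mat N N" "P \<in> carrier_mat N N" "Q \<in> carrier_mat N N"
    and QP: "Q * P = 1\<^sub>m N" and AP: "A * P = P * T"
  shows "similar_mat A T"
proof (rule similar_matI)
  show PQ: "P * Q = 1\<^sub>m N"
    by (rule mat_mult_left_right_inverse[OF assms(4,3) QP])
  have "P * T * Q = A * (P * Q)"
    unfolding AP[symmetric] using assms by (intro assoc_mult_mat)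
  then show "A = P * T * Q"
    unfolding PQ right_mult_one_mat[OF assms(1)] by (rule HOL.sym)
qed (use assms(1-5) in simp_all)

section \<open>Triangular form of the Laplacian of a complete multipartite graph\<close>

context
  fixes N :: nat and p :: "nat \<Rightarrow> 'c"
begin

definition part_size :: "nat \<Rightarrow> real" where "part_size i = real (card {w. w < N \<and> p w = p i})"
definition first_in_part :: "nat \<Rightarrow> bool" where "first_in_part i \<longleftrightarrow> (\<forall>j<i. p j \<noteq> p i)"

text \<open>
  Vertices are numbered, and each part is represented by its first vertex. Vector \<open>j\<close> of the basis is
  the constant function for \<open>j = 0\<close> (which also replaces the indicator of the part of vertex \<open>0\<close>), the
  indicator of a part for its representative \<open>j\<close>, and \<open>e\<^sub>j - e\<^sub>r\<close>, with \<open>r\<close> the representative of the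
  part of \<open>j\<close>, otherwise. The rows of the inverse matrix are the functions \<open>coord i\<close>.
\<close>

definition basis :: "nat \<Rightarrow> nat \<Rightarrow> real" where
  "basis j i = (if j = 0 then 1 else if first_in_part j then of_bool (p i = p j)
     else of_bool (i = j) - of_bool (first_in_part i \<and> p i = p j))"
text \<open>Degree minus adjacency: vertex \<open>i\<close> is joined to everything outside its
  part, so its degree is \<open>N - part_size i\<close>.\<close>

definition laplace :: "nat \<Rightarrow> nat \<Rightarrow> real" where
  "laplace i j = of_bool (i = j) * (real N - part_size i) - of_bool (p i \<noteq> p j)"
definition coord :: "nat \<Rightarrow> nat \<Rightarrow> real" where
  "coord i w = (if first_in_part i
     then of_bool (p w = p i) / part_size i - of_bool (i \<noteq> 0 \<and> p w = p 0) / part_size 0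
     else of_bool (i = w) - of_bool (p w = p i) / part_size i)"
text \<open>Column \<open>j\<close> holds the coordinates of the image of basis vector
  \<open>j\<close>. Off the diagonal, only indicators of parts contribute, through a multiple of the
  constant vector, which has index \<open>0\<close>.\<close>

definition triang :: "nat \<Rightarrow> nat \<Rightarrow> real" where
  "triang i j = (if i = j then if i = 0 then 0 else if first_in_part i then real N else real N - part_size i
     else if i = 0 \<and> first_in_part j then - part_size j else 0)"

lemma part_size_pos: "i < N \<Longrightarrow> part_size i > 0"
  unfolding part_size_def by (subst of_nat_0_less_iff, subst card_gt_0_iff) auto

lemma ex_first_in_part: assumes "i < N" shows "\<exists>r\<le>i. first_in_part r \<and> p r = p i"
proof -
  let ?r = "LEAST j. p j = p i"
  have "p ?r = p i" by (rule LeastI) simp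
  moreover have "?r \<le> i" by (rule Least_le) simp
  moreover have "first_in_part ?r" unfolding first_in_part_def using calculation(1) not_less_Least by metis
  ultimately show ?thesis by blast
qed

lemma first_in_part_unique: "first_in_part i \<Longrightarrow> first_in_part j \<Longrightarrow> p i = p j \<Longrightarrow> i = j"
  unfolding first_in_part_def by (metis linorder_neqE_nat)

lemma first_in_part_0 [simp]: "first_in_part 0" by (simp add: first_in_part_def)

lemma sum_first_in_part:
  assumes "i < N"
  shows "(\<Sum>w | w < N \<and> p w = p i. of_bool (first_in_part w)) = (1::real)"
proof -
  obtain r where r: "r \<le> i" "first_in_part r" "p r = p i" using ex_first_in_part[OF assms] by auto
  have "{w. w < N \<and> p w = p i} \<inter> {w. first_in_part w} = {r}"
    using r assms by (auto dest: first_in_part_unique)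
  then show ?thesis by (simp add: Int_def flip: sum.inter_filter)
qed

text \<open>A vector \<open>e_j - e_r\<close> sums to zero over every part because \<open>j\<close>
  and \<open>r\<close> share one; an indicator contributes only on its own part.\<close>

lemma part_sum_basis:
  assumes "i < N" "j < N"
  shows "(\<Sum>w | w < N \<and> p w = p i. basis j w) =
    (if j = 0 then part_size i else if first_in_part j \<and> p i = p j then part_size i else 0)"
proof (cases "first_in_part j")
  case True
  have "(\<Sum>w | w < N \<and> p w = p i. of_bool (p w = p j)) = (\<Sum>w | w < N \<and> p w = p i. of_bool (p i = p j) :: real)"
    by (rule sum.cong) auto
  then show ?thesis using True by (simp add: basis_def part_size_def)
next
  case False
  then have "j \<noteq> 0" by (metis first_in_part_0)
  have "(\<Sum>w | w < N \<and> p w = p i. of_bool (first_in_part w \<and> p w = p j)) =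
      (\<Sum>w | w < N \<and> p w = p i. of_bool (first_in_part w) * of_bool (p i = p j) :: real)"
    by (rule sum.cong) auto
  also have "\<dots> = (of_bool (p i = p j) :: real)"
    using sum_first_in_part[OF assms(1)] by (simp flip: sum_distrib_right)
  moreover have "(\<Sum>w | w < N \<and> p w = p i. of_bool (w = j)) = (of_bool (p i = p j) :: real)"
    using assms by (auto simp: of_bool_def)
  ultimately show ?thesis using False \<open>j \<noteq> 0\<close> by (simp add: basis_def sum_subtractf)
qed

lemma part_sum_conv: "(\<Sum>w<N. of_bool (p w = p i) * f w) = (\<Sum>w | w < N \<and> p w = p i. f w :: real)"
  by (rule sum.mono_neutral_cong_right) (auto simp: of_bool_def)

lemma total_sum_basis:
  assumes "j < N"
  shows "(\<Sum>w<N. basis j w) = (if j = 0 then real N else if first_in_part j then part_size j else 0)"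
proof (cases "j = 0")
  case False
  have "(\<Sum>w<N. basis j w) = (\<Sum>w | w < N \<and> p w = p j. basis j w)"
    by (rule sum.mono_neutral_right) (use False in \<open>auto simp: basis_def\<close>)
  then show ?thesis using part_sum_basis[OF assms assms] False by simp
qed (simp add: basis_def)

lemma part_size_cong: "p i = p j \<Longrightarrow> part_size i = part_size j" by (simp add: part_size_def)

context
  assumes N: "N > 0"
begin

text \<open>The matrix \<open>laplace\<close> is a diagonal matrix, minus the all-ones matrix, plus
  the same-part matrix. Its action on a basis vector thus needs only the values, the total sum and
  the part sums of that vector.\<close>

lemma laplace_basis:
  assumes "i < N" "j < N"
  shows "(\<Sum>w<N. laplace i w * basis j w) = (\<Sum>w<N. basis w i * triang w j)"
proof -
  have "(\<Sum>w<N. laplace i w * basis j w) =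
      (\<Sum>w<N. of_bool (w = i) * ((real N - part_size i) * basis j w) - basis j w
      + of_bool (p w = p i) * basis j w)"
    by (rule sum.cong) (auto simp: laplace_def)
  also have "\<dots> = (real N - part_size i) * basis j i - (\<Sum>w<N. basis j w) + (\<Sum>w | w < N \<and> p w = p i. basis j w)"
    using assms unfolding sum.distrib sum_subtractf part_sum_conv
    by (simp add: of_bool_def[of "_ = i"] if_distrib[of "\<lambda>x. x * _"] cong: if_cong)
  also have "\<dots> = basis j i * triang j j - of_bool (j \<noteq> 0 \<and> first_in_part j) * part_size j"
    unfolding part_sum_basis[OF assms] total_sum_basis[OF assms(2)]
    using part_size_cong[of i j] by (auto simp: triang_def basis_def algebra_simps)
  \<comment> \<open>Column \<open>j\<close> of \<open>triang\<close> as a diagonal part plus a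
    row-\<open>0\<close> part; the latter picks out basis vector \<open>0\<close>, which is
    constantly \<open>1\<close>.\<close>
  also have "\<dots> = (\<Sum>w<N. basis w i * (of_bool (w = j) * triang j j)
      + basis w i * (of_bool (w = 0) * (- of_bool (j \<noteq> 0 \<and> first_in_part j) * part_size j)))"
    using assms N by (simp add: sum.distrib sum_subtractf of_bool_def
      if_distrib[of "\<lambda>x. _ * x"] if_distrib[of "\<lambda>x. x * _"] cong: if_cong)
      (simp add: basis_def)
  also have "\<dots> = (\<Sum>w<N. basis w i * triang w j)"
    by (rule sum.cong) (auto simp: triang_def)
  finally show ?thesis .
qed

text \<open>\<open>coord\<close> reads off averages: coordinate \<open>0\<close> is the average over
  the part of vertex \<open>0\<close>, that of another representative is the average over its part
  minus this one, and that of any other vertex is its value minus the average over its part. Hence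
  only values and part sums of basis vectors enter.\<close>

lemma coord_basis:
  assumes "i < N" "j < N"
  shows "(\<Sum>w<N. coord i w * basis j w) = of_bool (i = j)"
proof -
  have "(\<Sum>w<N. coord i w * basis j w) = (\<Sum>w<N. of_bool (w = i) * (of_bool (\<not> first_in_part i) * basis j w)
     + of_bool (p w = p i) * basis j w * ((if first_in_part i then 1 else -1) / part_size i)
     + of_bool (p w = p 0) * basis j w * (- of_bool (first_in_part i \<and> i \<noteq> 0) / part_size 0))"
    by (rule sum.cong) (auto simp: coord_def algebra_simps)
  also have "\<dots> = of_bool (\<not> first_in_part i) * basis j i
     + (\<Sum>w | w < N \<and> p w = p i. basis j w) * ((if first_in_part i then 1 else -1) / part_size i)
     + (\<Sum>w | w < N \<and> p w = p 0. basis j w) * (- of_bool (first_in_part i \<and> i \<noteq> 0) / part_size 0)"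
    using assms unfolding sum.distrib part_sum_conv[symmetric] sum_distrib_right
    by (simp add: of_bool_def[of "_ = i"] if_distrib[of "\<lambda>x. x * _"] cong: if_cong)
  also have "\<dots> = of_bool (i = j)"
  proof -
    have "part_size i \<noteq> 0" "part_size 0 \<noteq> 0"
      using part_size_pos[OF assms(1)] part_size_pos[OF N] by simp_all
    moreover have "p i = p j \<longleftrightarrow> i = j" if "first_in_part i" "first_in_part j"
      using first_in_part_unique that by blast
    moreover have "p 0 = p j \<longleftrightarrow> j = 0" if "first_in_part j"
      using first_in_part_unique first_in_part_0 that by metis
    moreover have "j \<noteq> 0" if "\<not> first_in_part j"
      using that first_in_part_0 by metis
    moreover have "i \<noteq> j" if "first_in_part i \<noteq> first_in_part j"
      using that by blast
    ultimately show ?thesis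
      unfolding part_sum_basis[OF assms] part_sum_basis[OF N assms(2)]
      by (cases "first_in_part i"; cases "first_in_part j") (auto simp: basis_def of_bool_def)
  qed
  finally show ?thesis .
qed

lemma similar_laplace_triang:
  "similar_mat (mat N N (\<lambda>(i, j). laplace i j)) (mat N N (\<lambda>(i, j). triang i j))"
proof (rule similar_matI_left_inverse)
  let ?P = "mat N N (\<lambda>(i, j). basis j i)" and ?Q = "mat N N (\<lambda>(i, j). coord i j)"
  show "?Q * ?P = 1\<^sub>m N"
    using coord_basis by (intro eq_matI) (auto simp: scalar_prod_def atLeast0LessThan)
  show "mat N N (\<lambda>(i, j). laplace i j) * ?P = ?P * mat N N (\<lambda>(i, j). triang i j)"
    using laplace_basis by (intro eq_matI) (auto simp: scalar_prod_def atLeast0LessThan)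
qed auto

lemma proots_char_poly_laplace:
  "proots (char_poly (mat N N (\<lambda>(i, j). laplace i j))) = (\<Sum>i<N. {#triang i i#})"
proof -
  let ?T = "mat N N (\<lambda>(i, j). triang i j)"
  have "char_poly (mat N N (\<lambda>(i, j). laplace i j)) = (\<Prod>a\<leftarrow>diag_mat ?T. [:- a, 1:])"
    unfolding char_poly_similar[OF similar_laplace_triang]
    by (rule char_poly_upper_triangular) (auto simp: triang_def upper_triangular_def)
  then have "proots (char_poly (mat N N (\<lambda>(i, j). laplace i j))) = mset (diag_mat ?T)"
    by (simp only: proots_prod_list_linear)
  also have "diag_mat ?T = map (\<lambda>i. triang i i) [0..<N]"
    by (simp add: diag_mat_def)
  also have "mset \<dots> = (\<Sum>i<N. {#triang i i#})"
    by (simp add: atLeast0LessThan sum_unfold_sum_mset)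
  finally show ?thesis .
qed

text \<open>The diagonal is counted by kind of vertex: vertex \<open>0\<close> gives
  \<open>0\<close>, each further representative gives \<open>N\<close>, and a part of size
  \<open>s\<close> has \<open>s - 1\<close> other vertices, each giving
  \<open>N - s\<close>.\<close>

lemma sum_triang:
  "(\<Sum>i<N. {#triang i i#}) = {#0#} + replicate_mset (card (p ` {..<N}) - 1) (real N)
    + (\<Sum>c\<in>p ` {..<N}. replicate_mset (card {w. w < N \<and> p w = c} - 1)
        (real N - real (card {w. w < N \<and> p w = c})))"
proof -
  let ?F = "{i. i < N \<and> first_in_part i}" and ?R = "{i. i < N \<and> \<not> first_in_part i}"
  have "bij_betw p ?F (p ` {..<N})"
  proof -
    have "\<exists>r\<in>?F. p i = p r" if "i < N" for i
      using ex_first_in_part[OF that] that by (metis (mono_tags, lifting) mem_Collect_eq order.strict_trans1)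
    then show ?thesis unfolding bij_betw_def by (auto intro!: inj_onI dest: first_in_part_unique)
  qed
  then have cF: "card ?F = card (p ` {..<N})" by (rule bij_betw_same_card)
  have "{..<N} = insert 0 ((?F - {0}) \<union> ?R)" using N by auto
  then have "(\<Sum>i<N. {#triang i i#}) = (\<Sum>i\<in>insert 0 ((?F - {0}) \<union> ?R). {#triang i i#})" by simp
  also have "\<dots> = {#triang 0 0#} + ((\<Sum>i\<in>?F - {0}. {#triang i i#}) + (\<Sum>i\<in>?R. {#triang i i#}))"
    by (subst sum.insert; (subst sum.union_disjoint)?) auto
  also have "(\<Sum>i\<in>?F - {0}. {#triang i i#}) = (\<Sum>i\<in>?F - {0}. {#real N#})"
    by (rule sum.cong) (auto simp: triang_def)
  also have "\<dots> = replicate_mset (card (p ` {..<N}) - 1) (real N)"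
    unfolding sum_singleton_mset using N by (subst card_Diff_singleton) (auto simp: cF)
  also have "(\<Sum>i\<in>?R. {#triang i i#}) = (\<Sum>c\<in>p ` {..<N}. \<Sum>i\<in>{i. i \<in> ?R \<and> p i = c}. {#triang i i#})"
    by (rule sum.group[symmetric]) auto
  also have "\<dots> = (\<Sum>c\<in>p ` {..<N}. replicate_mset (card {w. w < N \<and> p w = c} - 1)
        (real N - real (card {w. w < N \<and> p w = c})))"
  proof (rule sum.cong)
    fix c assume "c \<in> p ` {..<N}"
    then obtain i where i: "i < N" "c = p i" by auto
    then obtain r where r: "r \<le> i" "first_in_part r" "p r = c" using ex_first_in_part by metis
    have "(\<Sum>i\<in>{i. i \<in> ?R \<and> p i = c}. {#triang i i#}) = (\<Sum>i\<in>{i. i \<in> ?R \<and> p i = c}. {#real N - part_size i#})"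
      by (rule sum.cong) (auto simp: triang_def)
    also have "\<dots> = (\<Sum>i\<in>{i. i \<in> ?R \<and> p i = c}. {#real N - real (card {w. w < N \<and> p w = c})#})"
      by (rule sum.cong) (auto simp: part_size_def)
    also have "\<dots> = replicate_mset (card {i. i \<in> ?R \<and> p i = c}) (real N - real (card {w. w < N \<and> p w = c}))"
      by (rule sum_singleton_mset)
    also have "card {i. i \<in> ?R \<and> p i = c} = card ({w. w < N \<and> p w = c} - {r})"
      using r by (intro arg_cong[where f = card]) (auto dest: first_in_part_unique)
    also have "\<dots> = card {w. w < N \<and> p w = c} - 1"
      using r i by (intro card_Diff_singleton) auto
    finally show "(\<Sum>i\<in>{i. i \<in> ?R \<and> p i = c}. {#triang i i#}) =
      replicate_mset (card {w. w < N \<and> p w = c} - 1) (real N - real (card {w. w < N \<and> p w = c}))" .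
  qed simp
  finally show ?thesis by (simp add: triang_def add.assoc)
qed

end

end

text \<open>\<open>f\<close> labels the parts. Listing the vertices turns the Laplacian matrix into
  \<open>laplace\<close>, and bijectivity of the listing preserves part sizes.\<close>

lemma laplacian_spectrum_complete_multipartite:
  fixes G :: "'a pair_pre_digraph" and f :: "'a \<Rightarrow> 'c"
  assumes fin: "finite (pverts G)" and ne: "pverts G \<noteq> {}"
    and arcs: "parcs G = {(x, y) \<in> pverts G \<times> pverts G. f x \<noteq> f y}"
  shows "laplacian_spectrum G = {#0#}
    + replicate_mset (card (f ` pverts G) - 1) (real (card (pverts G)))
    + (\<Sum>c\<in>f ` pverts G. replicate_mset (card {v \<in> pverts G. f v = c} - 1)
        (real (card (pverts G)) - real (card {v \<in> pverts G. f v = c})))"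
proof -
  obtain xs where xs: "distinct xs" "set xs = pverts G"
    using finite_distinct_list[OF fin] by auto
  define N where "N = length xs"
  define p where "p i = f (xs ! i)" for i
  have N0: "N > 0" using ne xs by (auto simp: N_def)
  have bij: "bij_betw ((!) xs) {..<N} (pverts G)"
    using bij_betw_nth[OF xs(1)] xs(2) by (simp add: N_def)
  have cN: "card (pverts G) = N" using bij_betw_same_card[OF bij] by simp
  have img: "p ` {..<N} = f ` pverts G"
    using bij_betw_imp_surj_on[OF bij] by (simp add: p_def flip: image_image)
  have cls: "card {w. w < N \<and> p w = c} = card {v \<in> pverts G. f v = c}" for c
  proof (rule bij_betw_same_card)
    show "bij_betw ((!) xs) {w. w < N \<and> p w = c} {v \<in> pverts G. f v = c}"
      using bij by (auto simp: bij_betw_def p_def inj_on_def image_iff)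
  qed
  have deg: "real (out_degree (with_proj G) v) = real N - real (card {w \<in> pverts G. f w = f v})"
    if v: "v \<in> pverts G" for v
  proof -
    have "out_arcs (with_proj G) v = Pair v ` (pverts G - {w \<in> pverts G. f w = f v})"
      using v by (auto simp: out_arcs_def arcs)
    then have "out_degree (with_proj G) v = card (pverts G - {w \<in> pverts G. f w = f v})"
      by (simp add: out_degree_def card_image inj_on_def)
    also have "\<dots> = N - card {w \<in> pverts G. f w = f v}"
      using fin by (subst card_Diff_subset) (auto simp: cN)
    moreover have "card {w \<in> pverts G. f w = f v} \<le> N"
      unfolding cN[symmetric] using fin by (intro card_mono) auto
    ultimately show ?thesis by simp
  qed
  have "laplacian_matrix G xs = mat N N (\<lambda>(i, j). laplace N p i j)"
  proof (rule eq_matI)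
    fix i j assume "i < dim_row (mat N N (\<lambda>(i, j). laplace N p i j))" "j < dim_col (mat N N (\<lambda>(i, j). laplace N p i j))"
    then have ij: "i < N" "j < N" by auto
    then have "xs ! i \<in> pverts G" "xs ! j \<in> pverts G" using xs N_def by (metis nth_mem)+
    then show "laplacian_matrix G xs $$ (i, j) = mat N N (\<lambda>(i, j). laplace N p i j) $$ (i, j)"
      using ij deg cls[of "p i"] unfolding laplacian_matrix_def degree_matrix_def adjacency_matrix_def
      by (simp add: laplace_def part_size_def arcs p_def flip: N_def)
  qed (auto simp: laplacian_matrix_def adjacency_matrix_def N_def)
  then show ?thesis
    unfolding laplacian_spectrum_eq[OF xs]
    by (simp only: proots_char_poly_laplace[OF N0] sum_triang[OF N0] cls img cN)
qed

section \<open>Normal form of the elements of the group\<close>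

text \<open>\<open>y x = z y\<close> says that conjugation by \<open>y\<close> sends
  \<open>x\<close> to \<open>z\<close>; being an automorphism, it respects powers. This inverse-free
  form also applies with \<open>inv y\<close> in place of \<open>y\<close>.\<close>

lemma (in group) pow_intertwine:
  assumes "x \<in> carrier G" "y \<in> carrier G" "z \<in> carrier G" "y \<otimes> x = z \<otimes> y"
  shows "y \<otimes> x [^] (k :: nat) = z [^] k \<otimes> y"
proof (induction k)
  case (Suc k)
  have "y \<otimes> x [^] Suc k = (y \<otimes> x [^] k) \<otimes> x"
    using assms by (simp add: m_assoc)
  also have "\<dots> = z [^] k \<otimes> (y \<otimes> x)"
    unfolding Suc using assms by (simp add: m_assoc)
  finally show ?case
    using assms by (simp add: m_assoc)
qed (use assms in simp)

lemma (in group) inv_intertwine_left: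
  assumes "x \<in> carrier G" "y \<in> carrier G" "z \<in> carrier G" "y \<otimes> x = z \<otimes> y"
  shows "inv y \<otimes> z = x \<otimes> inv y"
proof -
  have "inv y \<otimes> z = inv y \<otimes> (z \<otimes> y) \<otimes> inv y"
    using assms(1-3) by (simp add: m_assoc)
  also have "\<dots> = x \<otimes> inv y"
    unfolding assms(4)[symmetric] using assms(1-3) by (simp flip: m_assoc)
  finally show ?thesis .
qed

lemma (in group) inv_intertwine_right:
  assumes "x \<in> carrier G" "y \<in> carrier G" "z \<in> carrier G" "y \<otimes> x = z \<otimes> y"
  shows "y \<otimes> inv x = inv z \<otimes> y"
proof -
  have "y \<otimes> inv x = inv z \<otimes> (z \<otimes> y) \<otimes> inv x"
    using assms(1-3) by (simp flip: m_assoc)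
  also have "\<dots> = inv z \<otimes> y"
    unfolding assms(4)[symmetric] using assms(1-3) by (simp add: m_assoc)
  finally show ?thesis .
qed

lemma (in group) int_pow_intertwine:
  assumes "x \<in> carrier G" "y \<in> carrier G" "z \<in> carrier G" "y \<otimes> x = z \<otimes> y"
  shows "y \<otimes> x [^] (k :: int) = z [^] k \<otimes> y"
proof (cases k rule: int_cases2)
  case (nonneg n)
  then show ?thesis
    using pow_intertwine[OF assms] by (simp add: int_pow_int)
next
  case (nonpos n)
  then show ?thesis
    using pow_intertwine[OF _ assms(2) _ inv_intertwine_right[OF assms], of n] assms
    by (simp add: int_pow_neg int_pow_int nat_pow_inv)
qed

lemma (in group) int_pow_dvd_eq:
  assumes "x \<in> carrier G" "x [^] (m :: nat) = \<one>" "int m dvd i - j"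
  shows "x [^] i = x [^] j"
proof -
  obtain t where "i = int m * t + j"
    using assms(3) by (metis diff_add_cancel dvdE)
  then show ?thesis
    using assms by (simp add: int_pow_mult int_pow_int flip: int_pow_pow)
qed

section \<open>An invariant of words modulo the relations\<close>

definition neg_one_pow :: "int \<Rightarrow> int" where
  "neg_one_pow j = (if even j then 1 else - 1)"

text \<open>
  Evaluates a word in the infinite group \<open>\<int> \<rtimes> \<int>\<close> with product
  \<open>(i, j) (k, l) = (i + (-1)\<^sup>j k, j + l)\<close>. Reduced modulo \<open>m\<close> and \<open>2 n\<close> this is invariant under the
  defining relations, which bounds the order of the presented group from below.
\<close>

fun exponents :: "gen_ab letter list \<Rightarrow> int \<times> int" where
  "exponents [] = (0, 0)"
| "exponents (Pos Gen_a # w) = (1 + fst (exponents w), snd (exponents w))"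
| "exponents (Neg Gen_a # w) = (- 1 + fst (exponents w), snd (exponents w))"
| "exponents (Pos Gen_b # w) = (- fst (exponents w), 1 + snd (exponents w))"
| "exponents (Neg Gen_b # w) = (- fst (exponents w), - 1 + snd (exponents w))"

lemma exponents_append:
  "exponents (u @ v) =
    (fst (exponents u) + neg_one_pow (snd (exponents u)) * fst (exponents v), snd (exponents u) + snd (exponents v))"
  by (induction u rule: exponents.induct) (auto simp: neg_one_pow_def)

lemma exponents_replicate_a: "exponents (replicate i (Pos Gen_a)) = (int i, 0)"
  by (induction i) auto

lemma exponents_replicate_b: "exponents (replicate j (Pos Gen_b)) = (0, int j)"
  by (induction j) auto

definition M_rels :: "nat \<Rightarrow> nat \<Rightarrow> (gen_ab letter list \<times> gen_ab letter list) set" where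
  "M_rels m n =
     {(replicate m (Pos Gen_a), []),
      (replicate (2 * n) (Pos Gen_b), []),
      ([Pos Gen_b, Pos Gen_a, Neg Gen_b], [Neg Gen_a])}"

lemma M_group_eq: "M_group m n = presented_group (M_rels m n)"
  by (simp add: M_group_def M_rels_def)

text \<open>Induction over the congruence: each relation preserves the evaluation modulo
  \<open>m\<close> and \<open>2 n\<close>; in particular \<open>b a b^-1\<close> and
  \<open>a^-1\<close> both evaluate to \<open>(-1, 0)\<close>.\<close>

lemma word_eq_imp_exponents:
  assumes "word_eq (M_rels m n) u v"
  shows "int m dvd fst (exponents u) - fst (exponents v) \<and> int (2 * n) dvd snd (exponents u) - snd (exponents v)"
  using assms
proof induction
  case (rel u v)
  then show ?case by (auto simp: M_rels_def exponents_replicate_a exponents_replicate_b)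
next
  case (cancel_Pos_Neg g)
  then show ?case by (cases g) auto
next
  case (cancel_Neg_Pos g)
  then show ?case by (cases g) auto
next
  case (sym u v)
  then show ?case by (simp add: dvd_diff_commute)
next
  case (trans u v w)
  then show ?case
    using dvd_add[of "int m" "fst (exponents u) - fst (exponents v)" "fst (exponents v) - fst (exponents w)"]
      dvd_add[of "int (2 * n)" "snd (exponents u) - snd (exponents v)" "snd (exponents v) - snd (exponents w)"]
    by (simp del: of_nat_mult)
next
  case (append u u' v v')
  \<comment> \<open>Since \<open>2 n\<close> is even, congruent second exponents have equal parity,
    so they act by the same sign.\<close>
  have "even (snd (exponents u) - snd (exponents u'))"
    using append by (metis dvd_trans dvd_triv_left of_nat_mult of_nat_numeral)
  then have neg_one_pow: "neg_one_pow (snd (exponents u)) = neg_one_pow (snd (exponents u'))"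
    by (simp add: neg_one_pow_def)
  have "fst (exponents (u @ v)) - fst (exponents (u' @ v')) =
      (fst (exponents u) - fst (exponents u')) + neg_one_pow (snd (exponents u')) * (fst (exponents v) - fst (exponents v'))"
    by (simp add: exponents_append neg_one_pow algebra_simps)
  moreover have "snd (exponents (u @ v)) - snd (exponents (u' @ v')) =
      (snd (exponents u) - snd (exponents u')) + (snd (exponents v) - snd (exponents v'))"
    by (simp add: exponents_append)
  ultimately show ?case
    using append by (simp only: dvd_add dvd_mult)
qed simp

lemma word_class_replicate:
  "word_class R (replicate k x) = word_class R [x] [^]\<^bsub>presented_group R\<^esub> k"
proof (induction k)
  case 0
  show ?case by (simp add: presented_group_def nat_pow_def)
next
  case (Suc k)
  then show ?case
    using presented_group_mult[of R "replicate k x" "[x]"]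
    by (simp add: nat_pow_def flip: replicate_append_same)
qed

lemma word_class_in_carrier [simp]: "word_class R u \<in> carrier (presented_group R)"
  by (simp add: presented_group_def)

lemma word_class_Neg:
  "word_class R [Neg g] = inv\<^bsub>presented_group R\<^esub> word_class R [Pos g]"
proof -
  interpret group "presented_group R" by (rule group_presented_group)
  have "word_class R [Neg g] \<otimes>\<^bsub>presented_group R\<^esub> word_class R [Pos g] = \<one>\<^bsub>presented_group R\<^esub>"
    by (simp add: presented_group_mult)
      (simp add: presented_group_def word_class_eq_iff word_eq.cancel_Neg_Pos)
  then show ?thesis
    by (intro inv_equality[symmetric]) simp_all
qed

section \<open>Normal form \<open>a^i b^j\<close> and the commutation criterion\<close>

context
  fixes m n :: nat
begin

abbreviation "cls \<equiv> word_class (M_rels m n)"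
abbreviation "MG \<equiv> presented_group (M_rels m n)"

interpretation MG: group "presented_group (M_rels m n)" by (rule group_presented_group)

text \<open>The third relation lets \<open>b\<close> and its inverse pass a power of
  \<open>a\<close> at the cost of inverting that power. Prepending a letter therefore keeps the form
  \<open>a^i b^j\<close> and changes the exponents exactly as \<open>exponents\<close> does.\<close>

lemma word_class_eq_pow:
  "cls u = cls [Pos Gen_a] [^]\<^bsub>MG\<^esub> fst (exponents u) \<otimes>\<^bsub>MG\<^esub> cls [Pos Gen_b] [^]\<^bsub>MG\<^esub> snd (exponents u)"
proof -
  let ?A = "cls [Pos Gen_a]" and ?B = "cls [Pos Gen_b]"
  have "cls [Pos Gen_b, Pos Gen_a, Neg Gen_b] = cls [Neg Gen_a]"
    unfolding word_class_eq_iff by (rule word_eq.rel) (simp add: M_rels_def)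
  then have "?B \<otimes>\<^bsub>MG\<^esub> ?A \<otimes>\<^bsub>MG\<^esub> inv\<^bsub>MG\<^esub> ?B = inv\<^bsub>MG\<^esub> ?A"
    by (simp add: presented_group_mult flip: word_class_Neg)
  then have BA: "?B \<otimes>\<^bsub>MG\<^esub> ?A = inv\<^bsub>MG\<^esub> ?A \<otimes>\<^bsub>MG\<^esub> ?B"
    by (metis MG.inv_solve_right MG.inv_closed MG.m_closed word_class_in_carrier)
  have BA': "?B \<otimes>\<^bsub>MG\<^esub> ?A [^]\<^bsub>MG\<^esub> k = ?A [^]\<^bsub>MG\<^esub> (- k) \<otimes>\<^bsub>MG\<^esub> ?B" for k :: int
    using MG.int_pow_intertwine[OF _ _ _ BA, of k] by (simp add: MG.int_pow_neg MG.int_pow_inv)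
  have "inv\<^bsub>MG\<^esub> ?B \<otimes>\<^bsub>MG\<^esub> inv\<^bsub>MG\<^esub> ?A = ?A \<otimes>\<^bsub>MG\<^esub> inv\<^bsub>MG\<^esub> ?B"
    by (rule MG.inv_intertwine_left[OF _ _ _ BA]) simp_all
  \<comment> \<open>This moves powers of \<open>inv ?A\<close>; negating \<open>k\<close> gives the
    rule for powers of \<open>?A\<close>.\<close>
  from MG.int_pow_intertwine[OF _ _ _ this]
  have BA'': "inv\<^bsub>MG\<^esub> ?B \<otimes>\<^bsub>MG\<^esub> ?A [^]\<^bsub>MG\<^esub> k = ?A [^]\<^bsub>MG\<^esub> (- k) \<otimes>\<^bsub>MG\<^esub> inv\<^bsub>MG\<^esub> ?B" for k :: int
    by (metis MG.int_pow_inv MG.int_pow_neg MG.inv_closed MG.inv_inv word_class_in_carrier add.inverse_inverse)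
  have Cons: "cls (x # u) = cls [x] \<otimes>\<^bsub>MG\<^esub> cls u" for x u
    by (simp add: presented_group_mult)
  have "?B [^]\<^bsub>MG\<^esub> (1 + k) = ?B \<otimes>\<^bsub>MG\<^esub> ?B [^]\<^bsub>MG\<^esub> k"
    "?A [^]\<^bsub>MG\<^esub> (1 + k) = ?A \<otimes>\<^bsub>MG\<^esub> ?A [^]\<^bsub>MG\<^esub> k"
    "?B [^]\<^bsub>MG\<^esub> (- 1 + k) = inv\<^bsub>MG\<^esub> ?B \<otimes>\<^bsub>MG\<^esub> ?B [^]\<^bsub>MG\<^esub> k"
    "?A [^]\<^bsub>MG\<^esub> (- 1 + k) = inv\<^bsub>MG\<^esub> ?A \<otimes>\<^bsub>MG\<^esub> ?A [^]\<^bsub>MG\<^esub> k" for k :: int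
    by (simp_all only: MG.int_pow_mult word_class_in_carrier MG.int_pow_neg MG.int_pow_1)
  note pow = this(1,2) this(3,4)[simplified uminus_add_conv_diff]
  show ?thesis
  proof (induction u rule: exponents.induct)
    case 1
    then show ?case
      by (simp add: presented_group_def int_pow_def nat_pow_def
          presented_group_mult[unfolded presented_group_def, simplified])
  next
    case (2 w)
    show ?case
      by (subst Cons, subst 2) (simp add: pow MG.m_assoc)
  next
    case (3 w)
    show ?case
      by (subst Cons, subst 3, subst word_class_Neg) (simp add: pow MG.m_assoc)
  next
    case (4 w)
    show ?case
      by (subst Cons, subst 4) (simp add: pow BA' flip: MG.m_assoc)
  next
    case (5 w)
    show ?case
      by (subst Cons, subst 5, subst word_class_Neg) (simp add: pow BA'' flip: MG.m_assoc)
  qed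
qed

text \<open>The invariant separates elements with incongruent exponents; conversely, the normal form
  depends only on the exponents modulo \<open>m\<close> and \<open>2 n\<close>, as
  \<open>a^m\<close> and \<open>b^(2n)\<close> are trivial.\<close>

lemma word_class_M_rels_eq_iff:
  "cls u = cls v \<longleftrightarrow>
    int m dvd fst (exponents u) - fst (exponents v) \<and> int (2 * n) dvd snd (exponents u) - snd (exponents v)"
proof
  assume "cls u = cls v"
  then show "int m dvd fst (exponents u) - fst (exponents v) \<and> int (2 * n) dvd snd (exponents u) - snd (exponents v)"
    by (intro word_eq_imp_exponents) (simp add: word_class_eq_iff)
next
  have "cls (replicate m (Pos Gen_a)) = cls []" "cls (replicate (2 * n) (Pos Gen_b)) = cls []"
    unfolding word_class_eq_iff by (rule word_eq.rel; simp add: M_rels_def)+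
  then have "cls [Pos Gen_a] [^]\<^bsub>MG\<^esub> m = \<one>\<^bsub>MG\<^esub>" "cls [Pos Gen_b] [^]\<^bsub>MG\<^esub> (2 * n) = \<one>\<^bsub>MG\<^esub>"
    unfolding word_class_replicate by (simp_all add: presented_group_def)
  then show "cls u = cls v"
    if "int m dvd fst (exponents u) - fst (exponents v) \<and> int (2 * n) dvd snd (exponents u) - snd (exponents v)"
    using that MG.int_pow_dvd_eq word_class_in_carrier
    unfolding word_class_eq_pow[of u] word_class_eq_pow[of v] by metis
qed

definition M_elt :: "nat \<times> nat \<Rightarrow> gen_ab letter list set" where
  "M_elt = (\<lambda>(i, j). cls (replicate i (Pos Gen_a) @ replicate j (Pos Gen_b)))"

lemma exponents_M_elt: "exponents (replicate i (Pos Gen_a) @ replicate j (Pos Gen_b)) = (int i, int j)"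
  by (simp add: exponents_append exponents_replicate_a exponents_replicate_b neg_one_pow_def)

text \<open>Reducing the exponents of a word reaches every element, and congruent exponents in these
  ranges coincide, so the group has order \<open>2 m n\<close>.\<close>

lemma bij_betw_M_elt:
  assumes "m > 0" "n > 0"
  shows "bij_betw M_elt ({..<m} \<times> {..<2 * n}) (carrier (M_group m n))"
  unfolding bij_betw_def
proof
  show "inj_on M_elt ({..<m} \<times> {..<2 * n})"
  proof (rule inj_onI)
    have small: "i = j" if "int k dvd int i - int j" "i < k" "j < k" for i j k
      using that by (metis mod_eq_dvd_iff mod_less of_nat_eq_iff zmod_int)
    fix x y assume "x \<in> {..<m} \<times> {..<2 * n}" "y \<in> {..<m} \<times> {..<2 * n}" "M_elt x = M_elt y"
    then show "x = y"
      by (auto simp: M_elt_def word_class_M_rels_eq_iff exponents_M_elt intro!: small simp del: of_nat_mult)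
  qed
  show "M_elt ` ({..<m} \<times> {..<2 * n}) = carrier (M_group m n)"
  proof -
    have "cls u \<in> M_elt ` ({..<m} \<times> {..<2 * n})" for u
    proof (rule image_eqI)
      let ?i = "nat (fst (exponents u) mod int m)" and ?j = "nat (snd (exponents u) mod int (2 * n))"
      have *: "int ?i = fst (exponents u) mod int m" "int ?j = snd (exponents u) mod int (2 * n)"
        using assms by (simp_all del: of_nat_mult)
      show "cls u = M_elt (?i, ?j)"
        unfolding M_elt_def prod.case word_class_M_rels_eq_iff exponents_M_elt fst_conv snd_conv *
        by (simp add: minus_mod_eq_mult_div del: of_nat_mult)
      have "fst (exponents u) mod int m < int m" "snd (exponents u) mod int (2 * n) < int (2 * n)"
        using assms by (simp_all del: of_nat_mult)
      then show "(?i, ?j) \<in> {..<m} \<times> {..<2 * n}"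
        using assms by (simp add: nat_less_iff del: of_nat_mult)
    qed
    then show ?thesis
      by (auto simp: M_group_eq presented_group_def M_elt_def)
  qed
qed

text \<open>Both products have \<open>b\<close>-exponent \<open>j + l\<close>, so only the
  congruence between the \<open>a\<close>-exponents remains.\<close>

lemma M_elt_commute_iff:
  "M_elt (i, j) \<otimes>\<^bsub>M_group m n\<^esub> M_elt (k, l) = M_elt (k, l) \<otimes>\<^bsub>M_group m n\<^esub> M_elt (i, j) \<longleftrightarrow>
    int m dvd (int i + neg_one_pow (int j) * int k) - (int k + neg_one_pow (int l) * int i)"
  unfolding M_elt_def prod.case M_group_eq presented_group_mult word_class_M_rels_eq_iff
    exponents_append[of "_ @ _" "_ @ _"] exponents_M_elt
  by simp

end

lemma card_mod_eq:
  fixes c d q :: nat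
  assumes "c < d"
  shows "card {i. i < d * q \<and> i mod d = c} = q"
proof -
  have "bij_betw (\<lambda>k. c + d * k) {..<q} {i. i < d * q \<and> i mod d = c}"
  proof (rule bij_betw_byWitness[where f' = "\<lambda>i. i div d"])
    have "c + d * k < d * q" if "k < q" for k
    proof -
      have "c + d * k < d * Suc k" using assms by simp
      also have "\<dots> \<le> d * q" using that by (intro mult_le_mono2) simp
      finally show ?thesis .
    qed
    then show "(\<lambda>k. c + d * k) ` {..<q} \<subseteq> {i. i < d * q \<and> i mod d = c}"
      using assms by auto
  qed (use assms in \<open>auto simp: less_mult_imp_div_less mult.commute\<close>)
  then show ?thesis
    using bij_betw_same_card by fastforce
qed

section \<open>The non-commuting graph as a complete multipartite graph\<close>

text \<open>Treats both parities at once, with \<open>(d, q)\<close> equal to \<open>(m, 1)\<close>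
  or \<open>(m / 2, 2)\<close>. The centre has order \<open>q n\<close>, so
  \<open>N = 2 m n - q n\<close> vertices remain: \<open>d\<close> parts of size \<open>q n\<close>
  and one of size \<open>m n - q n\<close>. The \<open>d + 1\<close> parts yield \<open>N\<close>
  with multiplicity \<open>d\<close>, the small parts \<open>N - q n\<close>, and the last part
  \<open>N - (m n - q n) = m n\<close>.\<close>

lemma laplacian_spectrum_M_group:
  fixes m n d q :: nat
  assumes m: "m > 2" and n: "n > 0" and d: "d > 1" and mdq: "m = d * q"
    and dvd: "\<And>x :: int. int m dvd 2 * x \<longleftrightarrow> int d dvd x"
  shows "laplacian_spectrum (non_commuting_graph (M_group m n)) =
    {#0#} + replicate_mset (m * n - q * n - 1) (real m * real n)
      + replicate_mset (d * (q * n - 1)) (2 * real m * real n - 2 * (real q * real n))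
      + replicate_mset d (2 * real m * real n - real q * real n)"
proof -
  let ?G = "M_group m n" and ?h = "M_elt m n"
  define X where "X = {..<m} \<times> {..<2 * n}"
  define W where "W = {x \<in> X. \<not> (even (snd x) \<and> d dvd fst x)}"
  \<comment> \<open>Label of the part: \<open>d\<close> marks even powers of \<open>b\<close> and
    cannot collide with a residue modulo \<open>d\<close>.\<close>
  define F where "F = (\<lambda>x :: nat \<times> nat. if even (snd x) then d else fst x mod d)"
  define f where "f = F \<circ> the_inv_into X ?h"
  have bij: "bij_betw ?h X (carrier ?G)"
    unfolding X_def using m n by (intro bij_betw_M_elt) auto
  then have inj: "inj_on ?h X" and surj: "?h ` X = carrier ?G"
    by (auto simp: bij_betw_def)
  have f_M_elt: "f (?h x) = F x" if "x \<in> X" for x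
    using that inj by (simp add: f_def the_inv_into_f_f)

  have comm: "?h x \<otimes>\<^bsub>?G\<^esub> ?h y = ?h y \<otimes>\<^bsub>?G\<^esub> ?h x \<longleftrightarrow>
    (if even (snd x) then if even (snd y) then True else d dvd fst x
     else if even (snd y) then d dvd fst y else fst x mod d = fst y mod d)" for x y
  proof (cases x; cases y)
    fix i j k l assume xy: "x = (i, j)" "y = (k, l)"
    \<comment> \<open>With both powers of \<open>b\<close> odd the exponents differ by
      \<open>2 (i - k)\<close>; the mixed cases below give \<open>2 i\<close> and
      \<open>- 2 k\<close>.\<close>
    have "int m dvd (int i - int k) - (int k - int i) \<longleftrightarrow> int d dvd int i - int k"
      using dvd[of "int i - int k"] by (simp add: algebra_simps)
    also have "\<dots> \<longleftrightarrow> i mod d = k mod d"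
      by (metis mod_eq_dvd_iff of_nat_eq_iff zmod_int)
    finally have 1: "int m dvd (int i - int k) - (int k - int i) \<longleftrightarrow> i mod d = k mod d" .
    have 2: "int m dvd int i + int k - (int k - int i) \<longleftrightarrow> d dvd i"
      using dvd[of "int i"] by simp
    have 3: "int m dvd int i - int k - (int k + int i) \<longleftrightarrow> d dvd k"
      using dvd[of "- int k"] by simp
    show ?thesis
      unfolding xy M_elt_commute_iff using 1 2 3 by (simp add: neg_one_pow_def)
  qed

  have center: "?h x \<in> group_center ?G \<longleftrightarrow> even (snd x) \<and> d dvd fst x" if x: "x \<in> X" for x
  proof
    assume "?h x \<in> group_center ?G"
    then have *: "?h x \<otimes>\<^bsub>?G\<^esub> ?h y = ?h y \<otimes>\<^bsub>?G\<^esub> ?h x" if "y \<in> X" for y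
      using that surj by (auto simp: group_center_def)
    \<comment> \<open>The test elements are \<open>a\<close> and \<open>b\<close>: commuting with
      \<open>a\<close> forces \<open>snd x\<close> even because \<open>d > 1\<close>, and then
      commuting with \<open>b\<close> forces \<open>d dvd fst x\<close>.\<close>
    have "(1, 0) \<in> X" "(0, 1) \<in> X" using m n by (auto simp: X_def)
    from this[THEN *] show "even (snd x) \<and> d dvd fst x"
      using d by (auto simp: comm split: if_splits)
  next
    assume c: "even (snd x) \<and> d dvd fst x"
    have "?h x \<otimes>\<^bsub>?G\<^esub> z = z \<otimes>\<^bsub>?G\<^esub> ?h x" if "z \<in> carrier ?G" for z
    proof -
      from that obtain y where "z = ?h y"
        unfolding surj[symmetric] by blast
      then show ?thesis
        using c comm[of x y] by simp
    qed
    then show "?h x \<in> group_center ?G"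
      using x surj by (auto simp: group_center_def)
  qed

  have V: "pverts (non_commuting_graph ?G) = ?h ` W"
    unfolding non_commuting_graph_def Let_def W_def surj[symmetric] using center by auto
  have WX: "W \<subseteq> X" by (auto simp: W_def)
  \<comment> \<open>Excluding the centre settles mixed parity: an element with even
    \<open>snd\<close> commutes with one with odd \<open>snd\<close> only if it is central.\<close>
  have commF: "?h x \<otimes>\<^bsub>?G\<^esub> ?h y \<noteq> ?h y \<otimes>\<^bsub>?G\<^esub> ?h x \<longleftrightarrow> F x \<noteq> F y" if "x \<in> W" "y \<in> W" for x y
  proof -
    have "k mod d < d" for k using d by simp
    then have "k mod d \<noteq> d" "d \<noteq> k mod d" for k by (metis less_irrefl)+
    then show ?thesis
      using that unfolding comm F_def W_def by auto
  qed
  have arcs: "parcs (non_commuting_graph ?G) =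
    {(x, y) \<in> pverts (non_commuting_graph ?G) \<times> pverts (non_commuting_graph ?G). f x \<noteq> f y}"
  proof -
    have "x \<otimes>\<^bsub>?G\<^esub> y = y \<otimes>\<^bsub>?G\<^esub> x \<longleftrightarrow> f x = f y"
      if in_W: "x \<in> ?h ` W" "y \<in> ?h ` W" for x y
    proof -
      obtain x' y' where xy: "x = ?h x'" "y = ?h y'" "x' \<in> W" "y' \<in> W"
        using in_W by (elim imageE)
      then have "x' \<in> X" "y' \<in> X"
        using WX by auto
      then show ?thesis
        using commF[OF xy(3,4)] by (simp add: xy(1,2) f_M_elt)
    qed
    moreover have "parcs (non_commuting_graph ?G) =
        {(x, y) \<in> ?h ` W \<times> ?h ` W. x \<otimes>\<^bsub>?G\<^esub> y \<noteq> y \<otimes>\<^bsub>?G\<^esub> x}"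
      unfolding V[symmetric] by (simp add: non_commuting_graph_def Let_def)
    ultimately show ?thesis
      unfolding V by (auto simp only: mem_Sigma_iff mem_Collect_eq split: prod.splits)
  qed

  have cW: "card {v \<in> ?h ` W. f v = c} = card {x \<in> W. F x = c}" for c
  proof -
    have "{v \<in> ?h ` W. f v = c} = ?h ` {x \<in> W. F x = c}"
      using WX f_M_elt by auto
    moreover have "inj_on ?h {x \<in> W. F x = c}"
      by (rule inj_on_subset[OF inj]) (use WX in blast)
    ultimately show ?thesis
      by (simp add: card_image)
  qed
  have even_odd: "card {j. j < 2 * n \<and> even j} = n" "card {j. j < 2 * n \<and> odd j} = n"
    using card_mod_eq[of 0 2 n] card_mod_eq[of 1 2 n] by (simp_all add: even_iff_mod_2_eq_zero odd_iff_mod_2_eq_one)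
  have class_odd: "card {x \<in> W. F x = c} = q * n" if "c < d" for c
  proof -
    have "{x \<in> W. F x = c} = {i. i < m \<and> i mod d = c} \<times> {j. j < 2 * n \<and> odd j}"
      using that by (auto simp: W_def X_def F_def)
    then show ?thesis
      using card_mod_eq[OF that, of q] even_odd by (simp add: card_cartesian_product mdq)
  qed
  have class_even: "card {x \<in> W. F x = d} = m * n - q * n"
  proof -
    have "k mod d \<noteq> d" for k using d by (metis mod_less_divisor less_irrefl gr_implies_not_zero not_gr_zero)
    \<comment> \<open>With even \<open>snd\<close>, the multiples of \<open>d\<close> are central
      and drop out.\<close>
    then have "{x \<in> W. F x = d} = ({..<m} - {i. i < m \<and> i mod d = 0}) \<times> {j. j < 2 * n \<and> even j}"
      by (auto simp: W_def X_def F_def mod_eq_0_iff_dvd)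
    moreover have "card ({..<m} - {i. i < m \<and> i mod d = 0}) = m - q"
      using card_mod_eq[of 0 d q] d by (subst card_Diff_subset) (auto simp: mdq)
    ultimately show ?thesis
      using even_odd by (simp add: card_cartesian_product diff_mult_distrib)
  qed
  have q: "q > 0" using m mdq by (cases q) auto
  \<comment> \<open>Makes the difference \<open>m n - q n\<close> exact and the part labelled
    \<open>d\<close> nonempty.\<close>
  have qm: "q * n < m * n" using d q n by (simp add: mdq)
  have imgF: "f ` ?h ` W = {..d}"
  proof -
    have "f ` ?h ` W = F ` W" using WX f_M_elt by (force simp: image_iff)
    also have "\<dots> = {..d}"
    proof
      show "F ` W \<subseteq> {..d}" using d by (auto simp: F_def less_imp_le)
      have "{x \<in> W. F x = c} \<noteq> {}" if "c \<le> d" for c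
      proof -
        have "card {x \<in> W. F x = c} > 0"
          using class_odd[of c] class_even that q n qm by (cases "c = d") auto
        then show ?thesis by (metis card.empty less_irrefl)
      qed
      then show "{..d} \<subseteq> F ` W" by blast
    qed
    finally show ?thesis .
  qed
  have finW: "finite W" using WX by (rule finite_subset) (simp add: X_def)
  \<comment> \<open>Stated as a sum to avoid truncated subtraction; \<open>q n\<close> is the order
    of the centre.\<close>
  have cardW: "card (?h ` W) + q * n = 2 * m * n"
  proof -
    have "card (?h ` W) = card W"
      using inj_on_subset[OF inj WX] by (rule card_image)
    also have "\<dots> = (\<Sum>c\<in>{..d}. card {x \<in> W. F x = c})"
    proof -
      have "F ` W \<subseteq> {..d}" using d by (auto simp: F_def less_imp_le)
      then show ?thesis
        using sum.group[OF finW, of "{..d}" F "\<lambda>_. 1 :: nat"] by simp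
    qed
    also have "\<dots> = d * (q * n) + (m * n - q * n)"
      using class_odd class_even by (simp add: lessThan_Suc_atMost[symmetric])
    also have "d * (q * n) = m * n"
      by (simp add: mdq)
    finally show ?thesis
      using qm unfolding mult.assoc by linarith
  qed
  then have rW: "real (card (?h ` W)) = 2 * real m * real n - real q * real n"
    using arg_cong[OF cardW, of real] by simp
  have "finite (?h ` W)" "?h ` W \<noteq> {}"
    using finW imgF by auto
  then have "laplacian_spectrum (non_commuting_graph ?G) = {#0#}
    + replicate_mset (card {..d} - 1) (real (card (?h ` W)))
    + (\<Sum>c\<in>{..d}. replicate_mset (card {x \<in> W. F x = c} - 1)
        (real (card (?h ` W)) - real (card {x \<in> W. F x = c})))"
    using laplacian_spectrum_complete_multipartite[OF _ _ arcs] unfolding V cW imgF by blast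
  also have "(\<Sum>c\<in>{..d}. replicate_mset (card {x \<in> W. F x = c} - 1)
        (real (card (?h ` W)) - real (card {x \<in> W. F x = c}))) =
      (\<Sum>c\<in>{..<d}. replicate_mset (q * n - 1) (real (card (?h ` W)) - real (q * n)))
      + replicate_mset (m * n - q * n - 1) (real (card (?h ` W)) - real (m * n - q * n))"
    using class_odd class_even by (simp add: lessThan_Suc_atMost[symmetric])
  also have "real (card (?h ` W)) - real (m * n - q * n) = real m * real n"
    using qm by (simp add: rW of_nat_diff)
  also have "real (card (?h ` W)) - real (q * n) = 2 * real m * real n - 2 * (real q * real n)"
    by (simp add: rW)
  also have "(\<Sum>c\<in>{..<d}. replicate_mset (q * n - 1) a) = replicate_mset (d * (q * n - 1)) a" for a :: real
    by (rule multiset_eqI) (simp add: count_sum)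
  finally show ?thesis by (simp add: rW)
qed

theorem corollary3p5:
  fixes m n :: nat
  assumes "m > 2" and "n \<ge> 1"
  shows "(odd m \<longrightarrow>
       laplacian_spectrum (non_commuting_graph (M_group m n)) =
         {#0#}
         + replicate_mset (m * n - n - 1) (real m * real n)
         + replicate_mset (m * n - m) (2 * real m * real n - 2 * real n)
         + replicate_mset m (2 * real m * real n - real n))
     \<and> (even m \<longrightarrow>
       laplacian_spectrum (non_commuting_graph (M_group m n)) =
         {#0#}
         + replicate_mset (m * n - 2 * n - 1) (real m * real n)
         + replicate_mset (m * n - m div 2) (2 * real m * real n - 4 * real n)
         + replicate_mset (m div 2) (2 * real m * real n - 2 * real n))"
proof (intro conjI impI)
  assume "odd m"
  \<comment> \<open>Two is invertible modulo \<open>m\<close>, so \<open>d = m\<close> and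
    \<open>q = 1\<close>; the multiplicity \<open>d (q n - 1)\<close> becomes
    \<open>m n - m\<close>.\<close>
  then have "coprime (int m) 2" by simp
  then have "int m dvd 2 * x \<longleftrightarrow> int m dvd x" for x
    by (simp add: coprime_dvd_mult_right_iff)
  then show "laplacian_spectrum (non_commuting_graph (M_group m n)) =
         {#0#}
         + replicate_mset (m * n - n - 1) (real m * real n)
         + replicate_mset (m * n - m) (2 * real m * real n - 2 * real n)
         + replicate_mset m (2 * real m * real n - real n)"
    using laplacian_spectrum_M_group[of m n m 1] assms by (simp add: diff_mult_distrib2)
next
  assume "even m"
  then obtain d where d: "m = d * 2" by (metis dvdE mult.commute)
  \<comment> \<open>Here \<open>d = m / 2\<close> and \<open>q = 2\<close>, so
    \<open>d (q n - 1)\<close> becomes \<open>m n - m / 2\<close>.\<close>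
  have "int m dvd 2 * x \<longleftrightarrow> int d dvd x" for x
    by (simp add: d mult.commute)
  then show "laplacian_spectrum (non_commuting_graph (M_group m n)) =
         {#0#}
         + replicate_mset (m * n - 2 * n - 1) (real m * real n)
         + replicate_mset (m * n - m div 2) (2 * real m * real n - 4 * real n)
         + replicate_mset (m div 2) (2 * real m * real n - 2 * real n)"
    using laplacian_spectrum_M_group[of m n d 2] assms by (simp add: d diff_mult_distrib2 mult.assoc)
qed

end
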